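(* Let $(H,+,\cdot,0,<)$ be an ordered commutative hemiring whose partial order $\leq$ is a total ordering. Let $F$ be a field that is also an $H$-pseudonormed ring (i.e. $F$ is equipped with an $H$-pseudonorm). Then every finite-dimensional $F$-algebra admits the structure of an $H$-pseudonormed ring (i.e. there exists an $H$-pseudonorm on it).
   Context: $(H,+,\cdot,0,\leq)$ is an ordered hemiring if: $(H,+,0,\leq)$ is a commutative ordered monoid (a commutative monoid with a partial order $\leq$ compatible with $+$); $(H,\cdot)$ is a semigroup, and $a\leq b$, $0\leq c$ imply $ac\leq bc$ and $ca\leq cb$ for all $a,b,c\in H$; multiplication distributes over addition on both sides, and $0h=h0=0$ for all $h\in H$. $H$ is commutative if its multiplication is commutative. We say $(H,+,\cdot,0,<)$ is an ordered hemiring if $(H,+,\cdot,0,\leq)$ is an ordered hemiring, the strict order $<$ is compatible with addition ($a<b$ implies $a+c<b+c$), and $a<b$, $0<c$ imply $ac<bc$ and $ca<cb$. A ring $R$ (not necessarily with identity) is an $H$-pseudonormed ring if there is a function $\Vert\cdot\Vert:R\to H$, called an $H$-pseudonorm, such that for all $r,s\in R$: $\Vert r\Vert\geq 0$, and $\Vert r\Vert=0$ if and only if $r=0$; $\Vert r-s\Vert\leq\Vert r\Vert+\Vert s\Vert$; and $\Vert rs\Vert\leq\Vert r\Vert\,\Vert s\Vert$. *)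

theory Defs
  imports Complex_Main
begin

text \<open>
  Ordered hemirings \<open>(H, +, \<cdot>, 0, \<le>)\<close> are exactly the library class \<^class>\<open>ordered_semiring_0\<close>.
  The class below describes ordered hemirings \<open>(H, +, \<cdot>, 0, <)\<close>; neither commutativity of
  multiplication nor totality of the order is included.
\<close>

class strict_ordered_hemiring = ordered_semiring_0 +
  assumes hemiring_add_strict_mono: "a < b \<Longrightarrow> a + c < b + c"
    and hemiring_mult_strict_right_mono: "a < b \<Longrightarrow> 0 < c \<Longrightarrow> a * c < b * c"
    and hemiring_mult_strict_left_mono: "a < b \<Longrightarrow> 0 < c \<Longrightarrow> c * a < c * b"

text \<open>The values may lie in any ordered hemiring; the class \<^class>\<open>ring\<close> does not require an identity.\<close>

definition pseudonorm :: "('r::ring \<Rightarrow> 'h::ordered_semiring_0) \<Rightarrow> bool" where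
  "pseudonorm N \<longleftrightarrow>
     (\<forall>r. 0 \<le> N r) \<and>
     (\<forall>r. N r = 0 \<longleftrightarrow> r = 0) \<and>
     (\<forall>r s. N (r - s) \<le> N r + N s) \<and>
     (\<forall>r s. N (r * s) \<le> N r * N s)"

text \<open>
  Associative algebras over a field, not necessarily with identity and not necessarily commutative;
  the zero algebra is allowed.
\<close>

locale field_algebra = vector_space scale
  for scale :: "'f::field \<Rightarrow> 'a::ring \<Rightarrow> 'a" +
  assumes scale_mult_left: "scale c (x * y) = scale c x * y"
    and scale_mult_right: "scale c (x * y) = x * scale c y"

definition finite_dimensional_algebra :: "('f::field \<Rightarrow> 'a::ring \<Rightarrow> 'a) \<Rightarrow> bool" where
  "finite_dimensional_algebra scale \<longleftrightarrow>
     field_algebra scale \<and> (\<exists>B. finite_dimensional_vector_space scale B)"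

end

theory Submission
  imports Defs
begin

text \<open>
  Fix a finite basis \<open>B\<close> of the algebra and put \<open>|x| = (\<Sum>b\<in>B. \<parallel>x\<^sub>b\<parallel>)\<close>, where \<open>x\<^sub>b\<close> are the coordinates
  of \<open>x\<close>. This is definite and subadditive, but it is submultiplicative only up to a factor: expanding
  \<open>x * y\<close> in the structure constants \<open>c\<^sub>i\<^sub>j\<^sub>k\<close> (the \<open>k\<close>-th coordinate of \<open>i * j\<close>) gives
  \<open>|x * y| \<le> M * (|x| * |y|)\<close> as soon as \<open>M\<close> dominates every \<open>\<Sum>k\<in>B. \<parallel>c\<^sub>i\<^sub>j\<^sub>k\<parallel>\<close>
  (\<open>coordinate_norm_mult\<close>). The factor is absorbed by multiplying the norm itself by \<open>M\<close>, which
  requires neither an identity nor inverses among the values: for \<open>\<parallel>x\<parallel> = M * |x|\<close>, commutativity of the values gives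
  \<open>\<parallel>x * y\<parallel> \<le> M * (M * (|x| * |y|)) = \<parallel>x\<parallel> * \<parallel>y\<parallel>\<close>. Definiteness survives multiplication by \<open>M\<close>
  because \<open>M > 0\<close> and products of positive elements are positive; to guarantee \<open>M > 0\<close> even when all
  structure constants vanish, \<open>\<parallel>1\<parallel>\<close> is added to \<open>M\<close>.
\<close>

text \<open>
  The hemiring of values need not have an identity, so this is stated over ordered commutative monoids.
\<close>

lemma single_le_sum:
  fixes f :: "'b \<Rightarrow> 'h::ordered_comm_monoid_add"
  assumes "i \<in> A" "finite A" "\<And>j. j \<in> A \<Longrightarrow> 0 \<le> f j"
  shows "f i \<le> sum f A"
  using sum_mono2[of A "{i}" f] assms by simp

lemma
  assumes "pseudonorm N"
  shows pseudonorm_nonneg: "0 \<le> N r"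
    and pseudonorm_eq_0_iff: "N r = 0 \<longleftrightarrow> r = 0"
    and pseudonorm_diff: "N (r - s) \<le> N r + N s"
    and pseudonorm_mult: "N (r * s) \<le> N r * N s"
  using assms unfolding pseudonorm_def by blast+

lemma pseudonorm_minus:
  assumes "pseudonorm N"
  shows "N (- r) \<le> N r"
  using pseudonorm_diff[OF assms, of 0 r] pseudonorm_eq_0_iff[OF assms, of 0] by simp

lemma pseudonorm_add:
  assumes "pseudonorm N"
  shows "N (r + s) \<le> N r + N s"
proof -
  have "N (r + s) \<le> N r + N (- s)"
    using pseudonorm_diff[OF assms, of r "- s"] by simp
  also have "\<dots> \<le> N r + N s"
    using pseudonorm_minus[OF assms] by (rule add_left_mono)
  finally show ?thesis .
qed

lemma pseudonorm_sum:
  assumes "pseudonorm N"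
  shows "N (sum f A) \<le> (\<Sum>a\<in>A. N (f a))"
proof (induction A rule: infinite_finite_induct)
  case (insert a A)
  have "N (sum f (insert a A)) \<le> N (f a) + N (sum f A)"
    using insert.hyps pseudonorm_add[OF assms] by simp
  also have "\<dots> \<le> N (f a) + (\<Sum>a\<in>A. N (f a))"
    using insert.IH by (rule add_left_mono)
  finally show ?case using insert.hyps by simp
qed (use pseudonorm_eq_0_iff[OF assms, of 0] in simp_all)

text \<open>
  This bounds the terms \<open>x\<^sub>i * y\<^sub>j * c\<^sub>i\<^sub>j\<^sub>k\<close> of a coordinate of a product. Monotonicity of
  multiplication applies because values of a pseudonorm are nonnegative.
\<close>

lemma pseudonorm_mult3:
  assumes "pseudonorm N"
  shows "N (r * s * t) \<le> N r * N s * N t"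
  using pseudonorm_mult[OF assms, of "r * s" t]
    mult_right_mono[OF pseudonorm_mult[OF assms, of r s] pseudonorm_nonneg[OF assms, of t]]
  by (rule order_trans)

text \<open>
  For a strict ordered hemiring, rescaling by a positive factor keeps a norm definite and turns the
  weak bound \<open>P (r * s) \<le> M * (P r * P s)\<close> into submultiplicativity.
\<close>

lemma pseudonorm_rescale:
  fixes P :: "'r::ring \<Rightarrow> 'h::{strict_ordered_hemiring, comm_semiring_0}"
  assumes nonneg: "\<And>r. 0 \<le> P r"
    and definite: "\<And>r. P r = 0 \<longleftrightarrow> r = 0"
    and diff: "\<And>r s. P (r - s) \<le> P r + P s"
    and mult: "\<And>r s. P (r * s) \<le> M * (P r * P s)"
    and pos: "0 < M"
  shows "pseudonorm (\<lambda>r. M * P r)"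
  unfolding pseudonorm_def
proof (intro conjI allI)
  have M: "0 \<le> M" using pos by simp
  fix r s :: 'r
  show "0 \<le> M * P r"
    using mult_left_mono[OF nonneg M, of r] by simp
  show "M * P r = 0 \<longleftrightarrow> r = 0"
  proof
    assume eq: "M * P r = 0"
    show "r = 0"
    proof (rule ccontr)
      assume "r \<noteq> 0"
      then have "0 < P r" using nonneg[of r] definite[of r] by (simp add: order_less_le)
      from hemiring_mult_strict_left_mono[OF this pos] eq show False by simp
    qed
  next
    assume "r = 0"
    then show "M * P r = 0" using definite[of r] by simp
  qed
  show "M * P (r - s) \<le> M * P r + M * P s"
    using mult_left_mono[OF diff M, of r s] by (simp add: distrib_left)
  show "M * P (r * s) \<le> M * P r * (M * P s)"
    using mult_left_mono[OF mult M, of r s] by (simp add: ac_simps)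
qed

locale based_algebra = field_algebra scale + finite_dimensional_vector_space scale Basis
  for scale :: "'f::field \<Rightarrow> 'a::ring \<Rightarrow> 'a" and Basis :: "'a set"
begin

abbreviation coord :: "'a \<Rightarrow> 'a \<Rightarrow> 'f" where
  "coord \<equiv> representation Basis"

definition coordinate_norm :: "('f \<Rightarrow> 'h::ordered_semiring_0) \<Rightarrow> 'a \<Rightarrow> 'h" where
  "coordinate_norm N x = (\<Sum>b\<in>Basis. N (coord x b))"

text \<open>
  The inner sums run over all structure constants; the summand \<open>N 1\<close> makes the bound positive even
  for an algebra with zero multiplication.
\<close>

definition structure_bound :: "('f \<Rightarrow> 'h::ordered_semiring_0) \<Rightarrow> 'h" where
  "structure_bound N = N 1 + (\<Sum>i\<in>Basis. \<Sum>j\<in>Basis. coordinate_norm N (i * j))"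

lemma in_span_Basis: "x \<in> span Basis"
  by (simp add: span_Basis)

lemma sum_coord: "(\<Sum>b\<in>Basis. scale (coord x b) b) = x"
  using sum_representation_eq[OF independent_Basis in_span_Basis finite_Basis subset_refl] .

text \<open>
  Multiplication is bilinear, so it is determined by the structure constants \<open>coord (i * j) k\<close>.
\<close>

lemma coord_mult:
  "coord (x * y) k = (\<Sum>i\<in>Basis. \<Sum>j\<in>Basis. coord x i * coord y j * coord (i * j) k)"
proof -
  have "x * y = (\<Sum>i\<in>Basis. scale (coord x i) i) * (\<Sum>j\<in>Basis. scale (coord y j) j)"
    by (simp only: sum_coord)
  also have "\<dots> = (\<Sum>i\<in>Basis. \<Sum>j\<in>Basis. scale (coord x i * coord y j) (i * j))"
    by (simp add: sum_product scale_mult_left[symmetric] scale_mult_right[symmetric] ac_simps)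
  finally have "x * y = (\<Sum>i\<in>Basis. \<Sum>j\<in>Basis. scale (coord x i * coord y j) (i * j))" .
  then show ?thesis
    by (simp add: representation_sum[OF independent_Basis in_span_Basis]
        representation_scale[OF independent_Basis in_span_Basis])
qed

lemma coordinate_norm_nonneg:
  assumes "pseudonorm N"
  shows "0 \<le> coordinate_norm N x"
  unfolding coordinate_norm_def by (intro sum_nonneg pseudonorm_nonneg assms)

lemma coordinate_norm_eq_0_iff:
  assumes "pseudonorm N"
  shows "coordinate_norm N x = 0 \<longleftrightarrow> x = 0"
proof
  assume "coordinate_norm N x = 0"
  then have "\<forall>b\<in>Basis. coord x b = 0"
    unfolding coordinate_norm_def
    by (simp add: sum_nonneg_eq_0_iff[OF finite_Basis] pseudonorm_nonneg[OF assms]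
        pseudonorm_eq_0_iff[OF assms])
  then show "x = 0"
    using sum_coord[of x] by simp
next
  assume "x = 0"
  then show "coordinate_norm N x = 0"
    unfolding coordinate_norm_def
    by (simp add: representation_zero pseudonorm_eq_0_iff[OF assms, THEN iffD2])
qed

lemma coordinate_norm_diff:
  assumes "pseudonorm N"
  shows "coordinate_norm N (x - y) \<le> coordinate_norm N x + coordinate_norm N y"
  unfolding coordinate_norm_def
    representation_diff[OF independent_Basis in_span_Basis in_span_Basis] sum.distrib[symmetric]
  by (intro sum_mono pseudonorm_diff assms)

lemma coordinate_norm_le_structure_bound:
  assumes N: "pseudonorm N" and "i \<in> Basis" "j \<in> Basis"
  shows "coordinate_norm N (i * j) \<le> structure_bound N"
proof -
  note nonneg = coordinate_norm_nonneg[OF N]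
  have "coordinate_norm N (i * j) \<le> (\<Sum>j\<in>Basis. coordinate_norm N (i * j))"
    using assms by (intro single_le_sum nonneg finite_Basis)
  also have "\<dots> \<le> (\<Sum>i\<in>Basis. \<Sum>j\<in>Basis. coordinate_norm N (i * j))"
    using assms by (intro single_le_sum[of i Basis "\<lambda>i. \<Sum>j\<in>Basis. coordinate_norm N (i * j)"]
        sum_nonneg nonneg finite_Basis)
  also have "\<dots> \<le> structure_bound N"
    unfolding structure_bound_def
    using add_right_mono[OF pseudonorm_nonneg[OF N, of 1]] by simp
  finally show ?thesis .
qed

lemma structure_bound_pos:
  assumes N: "pseudonorm N"
  shows "0 < structure_bound N"
proof -
  have "0 < N 1"
    using pseudonorm_nonneg[OF N, of 1] pseudonorm_eq_0_iff[OF N, of 1]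
    by (simp add: order_less_le)
  also have "\<dots> \<le> structure_bound N"
    unfolding structure_bound_def
    by (simp add: add_increasing2 sum_nonneg coordinate_norm_nonneg[OF N])
  finally show ?thesis .
qed

text \<open>
  Summing the estimates of the coordinates of a product over their index \<open>k\<close> first collects the structure
  constants of each pair \<open>i, j\<close> into \<open>coordinate_norm N (i * j)\<close>, which is bounded uniformly in the
  pair; what remains is the expansion of the product of the two norms.
\<close>

lemma coordinate_norm_mult:
  fixes N :: "'f \<Rightarrow> 'h::{ordered_semiring_0, comm_semiring_0}"
  assumes N: "pseudonorm N"
  shows "coordinate_norm N (x * y)
    \<le> structure_bound N * (coordinate_norm N x * coordinate_norm N y)"
proof -
  let ?t = "\<lambda>i j. N (coord x i) * N (coord y j)"
  have nonneg: "0 \<le> ?t i j" for i j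
    using mult_left_mono[OF pseudonorm_nonneg[OF N] pseudonorm_nonneg[OF N]] by simp
  have "coordinate_norm N (x * y)
      = (\<Sum>k\<in>Basis. N (\<Sum>i\<in>Basis. \<Sum>j\<in>Basis. coord x i * coord y j * coord (i * j) k))"
    by (simp add: coordinate_norm_def coord_mult[of x y])
  also have "\<dots> \<le> (\<Sum>k\<in>Basis. \<Sum>i\<in>Basis. N (\<Sum>j\<in>Basis. coord x i * coord y j * coord (i * j) k))"
    by (intro sum_mono pseudonorm_sum N)
  also have "\<dots> \<le> (\<Sum>k\<in>Basis. \<Sum>i\<in>Basis. \<Sum>j\<in>Basis. N (coord x i * coord y j * coord (i * j) k))"
    by (intro sum_mono pseudonorm_sum N)
  also have "\<dots> \<le> (\<Sum>k\<in>Basis. \<Sum>i\<in>Basis. \<Sum>j\<in>Basis. ?t i j * N (coord (i * j) k))"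
    by (intro sum_mono pseudonorm_mult3 N)
  also have "\<dots> = (\<Sum>i\<in>Basis. \<Sum>k\<in>Basis. \<Sum>j\<in>Basis. ?t i j * N (coord (i * j) k))"
    by (rule sum.swap)
  also have "\<dots> = (\<Sum>i\<in>Basis. \<Sum>j\<in>Basis. \<Sum>k\<in>Basis. ?t i j * N (coord (i * j) k))"
    by (intro sum.cong refl sum.swap)
  also have "\<dots> = (\<Sum>i\<in>Basis. \<Sum>j\<in>Basis. ?t i j * coordinate_norm N (i * j))"
    by (simp add: coordinate_norm_def sum_distrib_left)
  also have "\<dots> \<le> (\<Sum>i\<in>Basis. \<Sum>j\<in>Basis. ?t i j * structure_bound N)"
    by (intro sum_mono mult_left_mono coordinate_norm_le_structure_bound N nonneg)
  also have "\<dots> = (\<Sum>i\<in>Basis. \<Sum>j\<in>Basis. ?t i j) * structure_bound N"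
    by (simp add: sum_distrib_right)
  also have "\<dots> = structure_bound N * (coordinate_norm N x * coordinate_norm N y)"
    by (simp add: coordinate_norm_def sum_product mult.commute)
  finally show ?thesis .
qed

lemma pseudonorm_scaled_coordinate_norm:
  fixes N :: "'f \<Rightarrow> 'h::{strict_ordered_hemiring, comm_semiring_0}"
  assumes "pseudonorm N"
  shows "pseudonorm (\<lambda>x. structure_bound N * coordinate_norm N x)"
  using assms
  by (intro pseudonorm_rescale coordinate_norm_nonneg coordinate_norm_eq_0_iff
      coordinate_norm_diff coordinate_norm_mult structure_bound_pos)

end

theorem theorem2p3:
  fixes normF :: "'f::field \<Rightarrow> 'h::{strict_ordered_hemiring, comm_semiring_0, linorder}"
    and scale :: "'f \<Rightarrow> 'a::ring \<Rightarrow> 'a"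
  assumes "pseudonorm normF"
    and "finite_dimensional_algebra scale"
  shows "\<exists>normA :: 'a \<Rightarrow> 'h. pseudonorm normA"
proof -
  obtain B where "field_algebra scale" "finite_dimensional_vector_space scale B"
    using assms(2) unfolding finite_dimensional_algebra_def by blast
  then interpret based_algebra scale B
    by (rule based_algebra.intro)
  show ?thesis
    using pseudonorm_scaled_coordinate_norm[OF assms(1)] by blast
qed

end
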